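(* For every set of events $cs$, state predicates $s_1,s_2$, trace expressions $t_1,t_2$, event-set expression $E$ and $\sigma_1:\Sigma\to\Sigma$: $\Phi(s_1,\sigma_1,t_1)\,\mathbf{wr}_{cs}\,\mathcal{I}(s_2,t_2) = \forall tt_0,tt_1\bullet\mathcal{I}(s_1\wedge s_2\wedge tt_1\in(t_2{}^\frown tt_0)\parallel_{cs}t_1\wedge(t_2{}^\frown tt_0)\restriction cs = t_1\restriction cs,\ tt_1)$, and $\mathcal{E}(s_1,t_1,E)\,\mathbf{wr}_{cs}\,\mathcal{I}(s_2,t_2) = \forall tt_0,tt_1\bullet\mathcal{I}(s_1\wedge s_2\wedge tt_1\in(t_2{}^\frown tt_0)\parallel_{cs}t_1\wedge(t_2{}^\frown tt_0)\restriction cs = t_1\restriction cs,\ tt_1)$.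
   Context: UTP setting: relations are predicates over undashed (initial) and dashed (final) variables; $;$ is relational composition; $P\lhd c\rhd Q = (c\wedge P)\vee(\neg c\wedge Q)$. Observational variables: booleans $ok,ok',wait,wait'$; traces $tr,tr'$ (finite event sequences; $\le$ prefix, ${}^\frown$ concatenation, $-$ removal of a prefix); state $st,st'\in\Sigma$; refusal sets $ref,ref'$; $tt$ abbreviates $tr'-tr$. $\mathbf{R1}(P) = P\wedge tr\le tr'$; $\mathbf{R2}(P) = P[\langle\rangle,tr'-tr/tr,tr']\lhd tr\le tr'\rhd P$; $\mathbf{RR}(P) = \exists ok,ok',wait,wait'\bullet\mathbf{R1}(\mathbf{R2}(P))$; $\mathbf{RC}(P) = \mathbf{R1}(\mathbf{RR}(P);(tr'\le tr))$; $\mathbf{CRR}(P)=\exists ref\bullet\mathbf{RR}(P)$; $\mathbf{CRC}(P) = \exists ref\bullet\mathbf{RC}(P)$. $\mathit{true}_r = \mathbf{R1}(\mathit{true})$, $\neg_r P = \mathbf{R1}(\neg P)$, $P\Rightarrow_r Q = \neg_r P\vee Q$. For a state predicate $s$, trace-valued expression $t$, event-set-valued expression $A$ over $st$, and $\sigma:\Sigma\to\Sigma$: $\mathcal{I}(s,t) = \mathbf{CRC}(s\Rightarrow_r\neg_r(t\le tt))$; $\mathcal{E}(s,t,A) = \mathbf{CRR}(s\wedge tt = t\wedge\forall e\in A\bullet e\notin ref')$; $\Phi(s,\sigma,t) = \mathbf{CRR}(s\wedge st'=\sigma(st)\wedge tt=t)$. Lenses: a lens $X:V\Rightarrow\Sigma$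 is a pair $get_X,put_X$ with $get(put\,s\,v)=v$, $put(put\,s\,v')\,v = put\,s\,v$, $put\,s\,(get\,s)=s$; override $s_1\oplus_X s_2 = put_X\,s_1\,(get_X\,s_2)$; $\mathbf{0}$ is the lens with a singleton view ($put\,s\,v=s$). Parallel-by-merge: $P\parallel_M Q = (P_0\wedge Q_1\wedge v'=v);M$, with $v$ the tuple of all variables, $P_0$ ($Q_1$) obtained by renaming each dashed $x'$ of $P$ ($Q$) to $0.x$ ($1.x$), and $M$ relating $x,0.x,1.x$ to $x'$. Trace merge $\parallel_{cs}$: least function from pairs of event sequences to sets of sequences with $\langle\rangle\parallel_{cs}\langle\rangle = \{\langle\rangle\}$; $(e{:}u)\parallel_{cs}\langle\rangle$ and $\langle\rangle\parallel_{cs}(e{:}u)$ equal $\{\langle\rangle\}$ if $e\in cs$, otherwise $\{\langle e\rangle\}{}^\frown(u\parallel_{cs}\langle\rangle)$, resp. $\{\langle e\rangle\}{}^\frown(\langle\rangle\parallel_{cs}u)$; $(e{:}u_1)\parallel_{cs}(e{:}u_2) = \{\langle e\rangle\}{}^\frown(u_1\parallel_{cs}u_2)$ if $e\in cs$, else $\{\langle e\rangle\}{}^\frown(u_1\parallel_{cs}(e{:}u_2)\cup(e{:}u_1)\parallel_{cs}u_2)$; for $e_1\neq e_2$: $\{\langle\rangle\}$ if both in $cs$, $\{\langle e_2\rangle\}{}^\frown((e_1{:}u_1)\parallel_{cs}u_2)$ if only $e_1\in cs$, $\{\langle e_1\rangle\}{}^\frown(u_1\parallel_{cs}(e_2{:}u_2))$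 if only $e_2\in cs$, the union of these two if neither. $S{}^\frown T = \{a{}^\frown b\mid a\in S,b\in T\}$; $u\restriction cs$ is the subsequence of elements of $u$ in $cs$. Merge: $N_I = (tt\in0.tt\parallel_{cs}1.tt\wedge0.tt\restriction cs = 1.tt\restriction cs\wedge ref'\subseteq((0.ref\cup1.ref)\cap cs)\cup((0.ref\cap1.ref)\setminus cs)\wedge st' = (st\oplus_{\mathbf{0}}0.st)\oplus_{\mathbf{0}}1.st)$, with $0.tt = 0.tr - tr$, $1.tt = 1.tr-tr$. Weakest rely: $P\,\mathbf{wr}_{cs}\,Q = \neg_r((\neg_r Q)\parallel_{N_I;\mathit{true}_r}P)$. *)

theory Defs
  imports Main "HOL-Library.Sublist"
begin

text \<open>
  A UTP relation is a predicate on an initial (undashed) and a final (dashed) observation.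
\<close>

record ('e, 's) obs =
  ok   :: bool
  wait :: bool
  tr   :: "'e list"
  st   :: 's
  ref  :: "'e set"

type_synonym ('e, 's) urel = "('e, 's) obs \<Rightarrow> ('e, 's) obs \<Rightarrow> bool"

text \<open>
  Subtraction is made total in the usual way of trace algebras: the difference is empty when
  the second trace is not a prefix of the first.
\<close>

definition trace_minus :: "'e list \<Rightarrow> 'e list \<Rightarrow> 'e list" where
  "trace_minus u v = (if prefix v u then drop (length v) u else [])"

definition tt :: "('e, 's) obs \<Rightarrow> ('e, 's) obs \<Rightarrow> 'e list" where
  "tt x x' = trace_minus (tr x') (tr x)"

definition R1 :: "('e, 's) urel \<Rightarrow> ('e, 's) urel" where
  "R1 P = (\<lambda>x x'. P x x' \<and> prefix (tr x) (tr x'))"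

definition R2 :: "('e, 's) urel \<Rightarrow> ('e, 's) urel" where
  "R2 P = (\<lambda>x x'. if prefix (tr x) (tr x')
                  then P (x\<lparr>tr := []\<rparr>) (x'\<lparr>tr := trace_minus (tr x') (tr x)\<rparr>)
                  else P x x')"

definition RR :: "('e, 's) urel \<Rightarrow> ('e, 's) urel" where
  "RR P = (\<lambda>x x'. \<exists>k k' w w'.
             R1 (R2 P) (x\<lparr>ok := k, wait := w\<rparr>) (x'\<lparr>ok := k', wait := w'\<rparr>))"

definition RC :: "('e, 's) urel \<Rightarrow> ('e, 's) urel" where
  "RC P = R1 (RR P OO (\<lambda>x x'. prefix (tr x') (tr x)))"

definition CRR :: "('e, 's) urel \<Rightarrow> ('e, 's) urel" where
  "CRR P = (\<lambda>x x'. \<exists>r. RR P (x\<lparr>ref := r\<rparr>) x')"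

definition CRC :: "('e, 's) urel \<Rightarrow> ('e, 's) urel" where
  "CRC P = (\<lambda>x x'. \<exists>r. RC P (x\<lparr>ref := r\<rparr>) x')"

definition true_r :: "('e, 's) urel" where
  "true_r = R1 (\<lambda>x x'. True)"

definition not_r :: "('e, 's) urel \<Rightarrow> ('e, 's) urel" where
  "not_r P = R1 (\<lambda>x x'. \<not> P x x')"

definition imp_r :: "('e, 's) urel \<Rightarrow> ('e, 's) urel \<Rightarrow> ('e, 's) urel" where
  "imp_r P Q = (\<lambda>x x'. not_r P x x' \<or> Q x x')"

text \<open>State predicates and trace or event-set expressions are functions of the initial state.\<close>

definition rely :: "('s \<Rightarrow> bool) \<Rightarrow> ('s \<Rightarrow> 'e list) \<Rightarrow> ('e, 's) urel" ("\<I>") where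
  "\<I> s t = CRC (imp_r (\<lambda>x x'. s (st x)) (not_r (\<lambda>x x'. prefix (t (st x)) (tt x x'))))"

definition quiescent ::
    "('s \<Rightarrow> bool) \<Rightarrow> ('s \<Rightarrow> 'e list) \<Rightarrow> ('s \<Rightarrow> 'e set) \<Rightarrow> ('e, 's) urel" ("\<E>") where
  "\<E> s t A = CRR (\<lambda>x x'. s (st x) \<and> tt x x' = t (st x) \<and> (\<forall>e\<in>A (st x). e \<notin> ref x'))"

definition terminated ::
    "('s \<Rightarrow> bool) \<Rightarrow> ('s \<Rightarrow> 's) \<Rightarrow> ('s \<Rightarrow> 'e list) \<Rightarrow> ('e, 's) urel" ("\<Phi>") where
  "\<Phi> s \<sigma> t = CRR (\<lambda>x x'. s (st x) \<and> st x' = \<sigma> (st x) \<and> tt x x' = t (st x))"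

record ('v, 's) lens =
  lget :: "'s \<Rightarrow> 'v"
  lput :: "'s \<Rightarrow> 'v \<Rightarrow> 's"

definition is_lens :: "('v, 's) lens \<Rightarrow> bool" where
  "is_lens X \<longleftrightarrow>
     (\<forall>s v. lget X (lput X s v) = v) \<and>
     (\<forall>s v v'. lput X (lput X s v') v = lput X s v) \<and>
     (\<forall>s. lput X s (lget X s) = s)"

definition override :: "'s \<Rightarrow> ('v, 's) lens \<Rightarrow> 's \<Rightarrow> 's" where
  "override s1 X s2 = lput X s1 (lget X s2)"

definition zero_lens :: "(unit, 's) lens" where
  "zero_lens = \<lparr>lget = (\<lambda>s. ()), lput = (\<lambda>s v. s)\<rparr>"

lemma is_lens_zero_lens: "is_lens zero_lens"
  by (simp add: is_lens_def zero_lens_def)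

text \<open>
  The input of a merge predicate: the initial observation \<open>x\<close> together with the
  indexed copies \<open>0.x\<close> and \<open>1.x\<close>.
\<close>

record ('e, 's) merge_obs =
  prior :: "('e, 's) obs"
  lobs  :: "('e, 's) obs"
  robs  :: "('e, 's) obs"

type_synonym ('e, 's) merge = "('e, 's) merge_obs \<Rightarrow> ('e, 's) obs \<Rightarrow> bool"

definition par_by_merge ::
    "('e, 's) urel \<Rightarrow> ('e, 's) merge \<Rightarrow> ('e, 's) urel \<Rightarrow> ('e, 's) urel" where
  "par_by_merge P M Q =
     (\<lambda>x m. P x (lobs m) \<and> Q x (robs m) \<and> prior m = x) OO M"

definition set_append :: "'e list set \<Rightarrow> 'e list set \<Rightarrow> 'e list set" where
  "set_append S T = {a @ b | a b. a \<in> S \<and> b \<in> T}"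

text \<open>The defining equations are terminating, so they have a unique (hence least) solution.\<close>

fun trace_merge :: "'e set \<Rightarrow> 'e list \<Rightarrow> 'e list \<Rightarrow> 'e list set" where
  "trace_merge cs [] [] = {[]}"
| "trace_merge cs (e # u) [] =
     (if e \<in> cs then {[]} else set_append {[e]} (trace_merge cs u []))"
| "trace_merge cs [] (e # u) =
     (if e \<in> cs then {[]} else set_append {[e]} (trace_merge cs [] u))"
| "trace_merge cs (e1 # u1) (e2 # u2) =
     (if e1 = e2 then
        (if e1 \<in> cs
         then set_append {[e1]} (trace_merge cs u1 u2)
         else set_append {[e1]}
                (trace_merge cs u1 (e2 # u2) \<union> trace_merge cs (e1 # u1) u2))
      else if e1 \<in> cs \<and> e2 \<in> cs then {[]}
      else if e1 \<in> cs then set_append {[e2]} (trace_merge cs (e1 # u1) u2)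
      else if e2 \<in> cs then set_append {[e1]} (trace_merge cs u1 (e2 # u2))
      else set_append {[e1]} (trace_merge cs u1 (e2 # u2))
           \<union> set_append {[e2]} (trace_merge cs (e1 # u1) u2))"

definition trace_restrict :: "'e list \<Rightarrow> 'e set \<Rightarrow> 'e list" where
  "trace_restrict u cs = filter (\<lambda>e. e \<in> cs) u"

definition N_I :: "'e set \<Rightarrow> ('e, 's) merge" where
  "N_I cs = (\<lambda>m x'.
     (let x = prior m; tt0 = tt x (lobs m); tt1 = tt x (robs m);
          ref0 = ref (lobs m); ref1 = ref (robs m)
      in tt x x' \<in> trace_merge cs tt0 tt1
       \<and> trace_restrict tt0 cs = trace_restrict tt1 cs
       \<and> ref x' \<subseteq> ((ref0 \<union> ref1) \<inter> cs) \<union> ((ref0 \<inter> ref1) - cs)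
       \<and> st x' = override (override (st x) zero_lens (st (lobs m))) zero_lens (st (robs m))))"

definition wr :: "'e set \<Rightarrow> ('e, 's) urel \<Rightarrow> ('e, 's) urel \<Rightarrow> ('e, 's) urel" where
  "wr cs P Q = not_r (par_by_merge (not_r Q) (N_I cs OO true_r) P)"

end

theory Submission
  imports Defs
begin

text \<open>
  A rely \<open>\<I>(s, t)\<close> just says that the trace grows and, if \<open>s\<close> holds initially, does not extend
  \<open>t\<close>; it is prefix closed because being an extension of \<open>t\<close> is preserved by further events.
  The weakest rely therefore depends on its first argument only through the traces that this
  argument can contribute. Both \<open>\<Phi>(s\<^sub>1, \<sigma>, t\<^sub>1)\<close> and \<open>\<E>(s\<^sub>1, t\<^sub>1, E)\<close> contribute exactly
  \<open>t\<^sub>1\<close> under \<open>s\<^sub>1\<close>; the final state and the refusals are unconstrained by the merge when the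
  merged refusal set is taken empty.
\<close>

lemma prefix_trace_minus_mono:
  assumes "prefix u v" "prefix v w" "prefix t (trace_minus v u)"
  shows "prefix t (trace_minus w u)"
  using assms by (auto simp: trace_minus_def prefix_def)

lemma prefix_trace_minus_iff:
  assumes "prefix u w"
  shows "prefix t (trace_minus w u) \<longleftrightarrow> prefix (u @ t) w"
  using assms by (auto simp: trace_minus_def prefix_def)

text \<open>The guard of \<open>R1\<close> selects the first branch of \<open>R2\<close>, so
  \<open>P\<close> only sees a trace that starts at \<open>[]\<close> and ends at
  \<open>tt x x'\<close>.\<close>

lemma RR_iff:
  "RR P x x' \<longleftrightarrow> prefix (tr x) (tr x') \<and>
     (\<exists>k k' w w'. P (x\<lparr>ok := k, wait := w, tr := []\<rparr>) (x'\<lparr>ok := k', wait := w', tr := tt x x'\<rparr>))"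
  by (auto simp: RR_def R1_def R2_def tt_def)

lemma tt_Nil: "tr x = [] \<Longrightarrow> tt x x' = tr x'"
  by (simp add: tt_def trace_minus_def)

lemma RC_rely_iff:
  "RC (imp_r (\<lambda>x x'. s (st x)) (not_r (\<lambda>x x'. prefix (t (st x)) (tt x x')))) x x' \<longleftrightarrow>
     prefix (tr x) (tr x') \<and> (s (st x) \<longrightarrow> \<not> prefix (t (st x)) (tt x x'))"
  (is "?L \<longleftrightarrow> ?R")
proof
  assume ?L
  then obtain y where y: "prefix (tr x) (tr x')" "prefix (tr x') (tr y)"
      "s (st x) \<longrightarrow> \<not> prefix (t (st x)) (tt x y)"
    by (auto simp: RC_def R1_def RR_iff imp_r_def not_r_def tt_Nil elim!: relcomppE)
  then show ?R
    \<comment> \<open>An extension of \<open>t\<close> already reached at \<open>x'\<close> would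
      persist in the longer trace of \<open>y\<close>.\<close>
    unfolding tt_def using prefix_trace_minus_mono by blast
next
  assume ?R
  then show ?L
    by (auto simp: RC_def R1_def relcompp_apply RR_iff imp_r_def not_r_def tt_Nil intro!: exI[of _ x'])
qed

lemma rely_iff:
  "\<I> s t x x' \<longleftrightarrow> prefix (tr x) (tr x') \<and> (s (st x) \<longrightarrow> \<not> prefix (t (st x)) (tt x x'))"
  \<comment> \<open>\<open>tt\<close> stays folded until \<open>RC_rely_iff\<close> has matched;
    unfolding it then shows that it ignores the change of \<open>ref\<close>.\<close>
  by (simp add: rely_def CRC_def RC_rely_iff) (simp add: tt_def)

lemma quiescent_iff:
  "\<E> s t A x x' \<longleftrightarrow> prefix (tr x) (tr x') \<and> s (st x) \<and> tt x x' = t (st x) \<and>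
     (\<forall>e\<in>A (st x). e \<notin> ref x')"
  by (simp add: quiescent_def CRR_def RR_iff tt_Nil) (simp add: tt_def)

lemma terminated_iff:
  "\<Phi> s \<sigma> t x x' \<longleftrightarrow> prefix (tr x) (tr x') \<and> s (st x) \<and> st x' = \<sigma> (st x) \<and> tt x x' = t (st x)"
  by (simp add: terminated_def CRR_def RR_iff tt_Nil) (simp add: tt_def)

text \<open>
  The merge \<open>N_I\<close> does not force the merged trace to extend the initial one, but an intermediate
  trace that fails to do so has an empty \<open>tt\<close> and can be replaced by the initial trace.
\<close>

lemma N_I_true_r_iff:
  fixes x y l r :: "('e, 's) obs"
  assumes "prefix (tr x) (tr y)"
  shows "(N_I cs OO true_r) \<lparr>prior = x, lobs = l, robs = r\<rparr> y \<longleftrightarrow>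
     (\<exists>u. u \<in> trace_merge cs (tt x l) (tt x r) \<and>
          trace_restrict (tt x l) cs = trace_restrict (tt x r) cs \<and>
          prefix u (tt x y))" (is "?L \<longleftrightarrow> ?R")
proof
  assume ?L
  then obtain z where z: "tt x z \<in> trace_merge cs (tt x l) (tt x r)"
      "trace_restrict (tt x l) cs = trace_restrict (tt x r) cs" "prefix (tr z) (tr y)"
    by (auto simp: N_I_def Let_def true_r_def R1_def elim!: relcomppE)
  moreover have "prefix (tt x z) (tt x y)"
    using assms z(3) by (auto simp: tt_def trace_minus_def prefix_def)
  ultimately show ?R by blast
next
  assume ?R
  then obtain u where u: "u \<in> trace_merge cs (tt x l) (tt x r)"
      "trace_restrict (tt x l) cs = trace_restrict (tt x r) cs" "prefix u (tt x y)"
    by blast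
  \<comment> \<open>Keeping \<open>st x\<close> is forced: overriding through
    \<open>zero_lens\<close> returns its first argument.\<close>
  define z :: "('e, 's) obs" where "z = x\<lparr>tr := tr x @ u, ref := {}\<rparr>"
  have "tt x z = u"
    by (simp add: z_def tt_def trace_minus_def)
  then have "N_I cs \<lparr>prior = x, lobs = l, robs = r\<rparr> z"
    using u by (simp add: N_I_def z_def override_def zero_lens_def)
  moreover have "true_r z y"
    using u(3) assms by (simp add: true_r_def R1_def z_def tt_def prefix_trace_minus_iff)
  ultimately show ?L by blast
qed

text \<open>The left operand violates the rely exactly when its trace is \<open>t2 @ tt0\<close> for
  some suffix \<open>tt0\<close>, and \<open>true_r\<close> lets the merged trace grow. The outer
  negation turns these existentials into the quantifiers over \<open>tt0\<close> and
  \<open>tt1\<close>.\<close>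

lemma wr_rely:
  fixes P :: "('e, 's) urel" and s1 s2 :: "'s \<Rightarrow> bool" and t1 t2 :: "'s \<Rightarrow> 'e list"
  assumes sound: "\<And>x r. P x r \<Longrightarrow> s1 (st x) \<and> tt x r = t1 (st x)"
    and complete: "\<And>x. s1 (st x) \<Longrightarrow> \<exists>r. P x r"
  shows "wr cs P (\<I> s2 t2) =
           (\<lambda>x x'. \<forall>tt0 tt1.
              \<I> (\<lambda>v. s1 v \<and> s2 v
                     \<and> tt1 \<in> trace_merge cs (t2 v @ tt0) (t1 v)
                     \<and> trace_restrict (t2 v @ tt0) cs = trace_restrict (t1 v) cs)
                (\<lambda>v. tt1) x x')"
    (is "_ = ?rhs")
proof (intro ext)
  fix x x' :: "('e, 's) obs"
  let ?merged = "\<lambda>tt0 u. s1 (st x) \<and> s2 (st x) \<and>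
    u \<in> trace_merge cs (t2 (st x) @ tt0) (t1 (st x)) \<and>
    trace_restrict (t2 (st x) @ tt0) cs = trace_restrict (t1 (st x)) cs \<and> prefix u (tt x x')"
  have par: "par_by_merge (not_r (\<I> s2 t2)) (N_I cs OO true_r) P x x' \<longleftrightarrow> (\<exists>tt0 u. ?merged tt0 u)"
    (is "?L \<longleftrightarrow> ?R") if le: "prefix (tr x) (tr x')"
  proof
    assume ?L
    then obtain m where m: "not_r (\<I> s2 t2) x (lobs m)" "P x (robs m)" "prior m = x"
        "(N_I cs OO true_r) m x'"
      by (auto simp: par_by_merge_def)
    \<comment> \<open>The explicit record form is what \<open>N_I_true_r_iff\<close>
      matches.\<close>
    have "m = \<lparr>prior = x, lobs = lobs m, robs = robs m\<rparr>"
      using m(3) by simp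
    then obtain u where u: "u \<in> trace_merge cs (tt x (lobs m)) (tt x (robs m))"
        "trace_restrict (tt x (lobs m)) cs = trace_restrict (tt x (robs m)) cs"
        "prefix u (tt x x')"
      using m(4) N_I_true_r_iff[OF le] by metis
    from m(1) obtain tt0 where "s2 (st x)" "tt x (lobs m) = t2 (st x) @ tt0"
      by (auto simp: not_r_def R1_def rely_iff prefix_def)
    then show ?R
      using u sound[OF m(2)] by auto
  next
    assume ?R
    then obtain tt0 u where u: "?merged tt0 u" by blast
    define l :: "('e, 's) obs" where "l = x\<lparr>tr := tr x @ t2 (st x) @ tt0\<rparr>"
    obtain r where r: "P x r"
      using complete u by blast
    have l: "tt x l = t2 (st x) @ tt0"
      by (simp add: l_def tt_def trace_minus_def)
    then have "not_r (\<I> s2 t2) x l"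
      using u by (simp add: not_r_def R1_def rely_iff) (simp add: l_def)
    moreover have "(N_I cs OO true_r) \<lparr>prior = x, lobs = l, robs = r\<rparr> x'"
      using u l sound[OF r] N_I_true_r_iff[OF le] by auto
    ultimately show ?L
      using r by (auto simp: par_by_merge_def relcompp_apply
          intro!: exI[of _ "\<lparr>prior = x, lobs = l, robs = r\<rparr>"])
  qed
  show "wr cs P (\<I> s2 t2) x x' = ?rhs x x'"
    \<comment> \<open>If \<open>tr x\<close> is not a prefix of \<open>tr x'\<close>, both sides are
      false.\<close>
    using par by (auto simp: wr_def not_r_def R1_def rely_iff)
qed

lemma terminated_feasible: "s (st x) \<Longrightarrow> \<exists>r. \<Phi> s \<sigma> t x r"
  by (rule exI[of _ "x\<lparr>tr := tr x @ t (st x), st := \<sigma> (st x)\<rparr>"])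
    (simp add: terminated_iff tt_def trace_minus_def)

lemma quiescent_feasible: "s (st x) \<Longrightarrow> \<exists>r. \<E> s t A x r"
  \<comment> \<open>An empty final refusal set avoids every event of
    \<open>A (st x)\<close>.\<close>
  by (rule exI[of _ "x\<lparr>tr := tr x @ t (st x), ref := {}\<rparr>"])
    (simp add: quiescent_iff tt_def trace_minus_def)

theorem theorem43:
  fixes cs :: "'e set"
    and s1 s2 :: "'s \<Rightarrow> bool"
    and t1 t2 :: "'s \<Rightarrow> 'e list"
    and E :: "'s \<Rightarrow> 'e set"
    and \<sigma>1 :: "'s \<Rightarrow> 's"
  shows "wr cs (\<Phi> s1 \<sigma>1 t1) (\<I> s2 t2) =
           (\<lambda>x x'. \<forall>tt0 tt1.
              \<I> (\<lambda>v. s1 v \<and> s2 v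
                     \<and> tt1 \<in> trace_merge cs (t2 v @ tt0) (t1 v)
                     \<and> trace_restrict (t2 v @ tt0) cs = trace_restrict (t1 v) cs)
                (\<lambda>v. tt1) x x')
       \<and> wr cs (\<E> s1 t1 E) (\<I> s2 t2) =
           (\<lambda>x x'. \<forall>tt0 tt1.
              \<I> (\<lambda>v. s1 v \<and> s2 v
                     \<and> tt1 \<in> trace_merge cs (t2 v @ tt0) (t1 v)
                     \<and> trace_restrict (t2 v @ tt0) cs = trace_restrict (t1 v) cs)
                (\<lambda>v. tt1) x x')"
proof (rule conjI; rule wr_rely)
  show "\<exists>r. \<Phi> s1 \<sigma>1 t1 x r" if "s1 (st x)" for x
    using that by (rule terminated_feasible)
  show "\<exists>r. \<E> s1 t1 E x r" if "s1 (st x)" for x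
    using that by (rule quiescent_feasible)
qed (simp_all add: terminated_iff quiescent_iff)

end
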